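(* Let $\varphi_7:\mathbb{N}\to\mathbb{N}$ be the function defined as follows. The values $\varphi_7(0),\varphi_7(1),\dots,\varphi_7(29)$ are, in order, $$9,8,7,5,6,3,4,2,1,0,\ 17,16,19,18,21,20,11,10,13,12,\ 15,14,25,24,23,22,29,28,27,26,$$ and for $x\ge 30$, $\varphi_7(x)=x\oplus_2 5$. Then, for all nonnegative integers $a,b$, the Halve Nim position $a^1b^17^1$ is a $\mathcal{P}$-position if and only if $b=\varphi_7(a)$. Furthermore, for $a,b\ge 30$, $a^1b^17^1$ is a $\mathcal{P}$-position if and only if $(a+2)\oplus(b+2)=5$.
   Context: $\mathbb{N}$ is the set of nonnegative integers and $\oplus$ denotes bitwise XOR. The $n$-shifted bitwise sum is $x\oplus_n y=\bigl((x+n)\oplus y\bigr)-n$. Halve Nim is a two-player game played on finitely many piles of coins; players alternate moves and a player who cannot move loses. A move is one of: (i) choose one pile and remove at least one coin from it; (ii) halve the game: simultaneously replace every pile of $m$ coins by a pile of $\lfloor m/2\rfloor$ coins. When there are no coins left, no move is available (halving requires at least one coin to be present). A position is a $\mathcal{P}$-position if the player who is not about to move has a winning strategy (equivalently, every move from it leads to an $\mathcal{N}$-position), and an $\mathcal{N}$-position if the player about to move has a winning strategy. $a^1b^1c^1$ denotes the position with three piles of sizes $a$, $b$, $c$ (a pile of size $0$ is an empty pile); in particular $a^1b^17^1$ has piles of sizes $a$, $b$, $7$. *)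

theory Defs
  imports "HOL-Library.Multiset"
begin

text \<open>A position is the multiset of its pile sizes; empty piles are allowed.\<close>

type_synonym position = "nat multiset"

inductive move :: "position \<Rightarrow> position \<Rightarrow> bool" where
  remove: "\<lbrakk>m \<in># p; k < m\<rbrakk> \<Longrightarrow> move p (add_mset k (p - {#m#}))"
| halve: "\<lbrakk>m \<in># p; 0 < m\<rbrakk> \<Longrightarrow> move p (image_mset (\<lambda>x. x div 2) p)"

text \<open>
  Normal play: in a position without moves the player about to move has lost. A derivation of
  \<open>P_position p\<close> amounts to a winning strategy for the player not about to move, one of
  \<open>N_position p\<close> to a winning strategy for the player about to move.
\<close>

inductive P_position :: "position \<Rightarrow> bool" and N_position :: "position \<Rightarrow> bool" where
  P: "(\<And>q. move p q \<Longrightarrow> N_position q) \<Longrightarrow> P_position p"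
| N: "\<lbrakk>move p q; P_position q\<rbrakk> \<Longrightarrow> N_position p"

lemma move_decreases: "move p q \<Longrightarrow> \<Sum>\<^sub># q < \<Sum>\<^sub># p"
proof (induction rule: move.induct)
  case (remove m p k)
  then obtain r where "p = add_mset m r" by (metis multi_member_split)
  with remove show ?case by simp
next
  case (halve m p)
  then obtain r where r: "p = add_mset m r" by (metis multi_member_split)
  have "\<Sum>\<^sub># (image_mset (\<lambda>x. x div 2) r) \<le> \<Sum>\<^sub># r"
    by (induction r) (auto intro: add_mono)
  moreover have "m div 2 < m" using halve by simp
  ultimately show ?case using r by simp
qed

lemma N_position_iff: "N_position p \<longleftrightarrow> \<not> P_position p"
proof (induction "\<Sum>\<^sub># p" arbitrary: p rule: less_induct)
  case less
  have "N_position q \<longleftrightarrow> \<not> P_position q" if "move p q" for q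
    using less move_decreases[OF that] by blast
  then show ?case
    by (subst N_position.simps, subst P_position.simps) blast
qed

lemma P_position_iff: "P_position p \<longleftrightarrow> (\<forall>q. move p q \<longrightarrow> \<not> P_position q)"
  by (subst P_position.simps) (simp add: N_position_iff)

text \<open>
  The subtraction is truncated, but by \<open>shifted_xor_2_5\<close> below it does not truncate
  in the range where \<open>phi7\<close> uses it.
\<close>

definition shifted_xor :: "nat \<Rightarrow> nat \<Rightarrow> nat \<Rightarrow> nat" where
  "shifted_xor n x y = xor (x + n) y - n"

definition phi7 :: "nat \<Rightarrow> nat" where
  "phi7 x =
    (if x < 30
     then [9, 8, 7, 5, 6, 3, 4, 2, 1, 0, 17, 16, 19, 18, 21, 20, 11, 10, 13, 12,
           15, 14, 25, 24, 23, 22, 29, 28, 27, 26] ! x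
     else shifted_xor 2 x 5)"

lemma shifted_xor_2_5:
  assumes "30 \<le> x"
  shows "shifted_xor 2 x 5 + 2 = xor (x + 2) 5"
proof -
  have "xor (x + 2) 5 div 8 = (x + 2) div 8"
    using drop_bit_xor[of 3 "x + 2" 5] by (simp add: drop_bit_eq_div)
  then have "xor (x + 2) 5 \<ge> 2" using assms by linarith
  then show ?thesis by (simp add: shifted_xor_def)
qed

end

theory Submission
  imports Defs "HOL-Library.Code_Binary_Nat"
begin

text \<open>
  For fixed \<open>c\<close> the P-positions \<open>{#a, b, c#}\<close> form the graph of an involution \<open>phi c\<close>. Moves never
  increase \<open>c\<close>, so the eight rows \<open>c < 8\<close> are determined together, and explicit candidates for
  them are confirmed by induction on the number of coins. For \<open>a \<ge> 30\<close> the rows \<open>c \<ge> 4\<close> are given by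
  \<open>(a + 2) \<oplus> (b + 2) = c - 2\<close>, while the rows \<open>c < 4\<close> are \<open>a \<oplus> b = c\<close> or \<open>a \<oplus> b = c \<oplus> 2\<close>, alternating
  with the \<open>k\<close> for which \<open>7 * 2 ^ k \<le> a < 7 * 2 ^ (k + 1)\<close>. Halving moves \<open>a\<close> from one such interval to
  the previous one, so it switches between the two cases. Hence for large \<open>a\<close> the required
  laws depend only on \<open>a mod 16\<close> and on this parity, which leaves finitely many cases.
\<close>

section \<open>Moves with three piles and a criterion for the P-positions\<close>

lemma all_move_three_piles_iff:
  "(\<forall>q. move {#a, b, c#} q \<longrightarrow> R q) \<longleftrightarrow>
    (\<forall>a'<a. R {#a', b, c#}) \<and> (\<forall>b'<b. R {#a, b', c#}) \<and> (\<forall>c'<c. R {#a, b, c'#}) \<and>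
    ((a, b, c) \<noteq> (0, 0, 0) \<longrightarrow> R {#a div 2, b div 2, c div 2#})"
    (is "?lhs \<longleftrightarrow> ?rhs")
proof
  assume L: ?lhs
  have "R {#a', b, c#}" if "a' < a" for a'
    using L move.remove[of a "{#a, b, c#}" a'] that by auto
  moreover have "R {#a, b', c#}" if "b' < b" for b'
    using L move.remove[of b "{#a, b, c#}" b'] that by (auto simp: add_mset_commute)
  moreover have "R {#a, b, c'#}" if "c' < c" for c'
    using L move.remove[of c "{#a, b, c#}" c'] that by (auto simp: add_mset_commute)
  moreover have "R {#a div 2, b div 2, c div 2#}" if "(a, b, c) \<noteq> (0, 0, 0)"
    using L move.halve[of _ "{#a, b, c#}"] that by auto
  ultimately show ?rhs by blast
next
  assume R: ?rhs
  show ?lhs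
  proof (intro allI impI)
    fix q assume "move {#a, b, c#} q"
    then show "R q"
    proof cases
      case (remove m k)
      then consider "m = a" | "m = b" | "m = c" by auto
      then show ?thesis
        by cases (use R remove in \<open>auto simp: add_mset_commute\<close>)
    next
      case (halve m)
      then show ?thesis using R by auto
    qed
  qed
qed

text \<open>The P-positions are the unique set that no move stays inside and that some move enters
  from every position outside. Injectivity of the rows, \<open>apart\<close> and
  \<open>halve\<close> give the first property. If \<open>f c a < b\<close> or
  \<open>f c b < a\<close>, reducing that pile enters the graph; \<open>cover\<close> treats the
  remaining positions.\<close>

lemma P_position_three_piles_iff:
  fixes f :: "nat \<Rightarrow> nat \<Rightarrow> nat"
  assumes invol: "\<And>c a. c < n \<Longrightarrow> f c (f c a) = a"
    and apart: "\<And>c c' a. c < n \<Longrightarrow> c' < c \<Longrightarrow> f c' a \<noteq> f c a"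
    and halve: "\<And>c a. c < n \<Longrightarrow> (a, f c a, c) \<noteq> (0, 0, 0) \<Longrightarrow> f (c div 2) (a div 2) \<noteq> f c a div 2"
    and cover: "\<And>c a b. c < n \<Longrightarrow> a \<le> b \<Longrightarrow> b < f c a \<Longrightarrow> a < f c b \<Longrightarrow>
      (\<exists>c'<c. f c' a = b) \<or> f (c div 2) (a div 2) = b div 2"
    and "c < n"
  shows "P_position {#a, b, c#} \<longleftrightarrow> f c a = b"
  using \<open>c < n\<close>
proof (induction "a + b + c" arbitrary: a b c rule: less_induct)
  case less
  have f_eq_iff: "f k x = y \<longleftrightarrow> f k y = x" if "k < n" for k x y
    using invol[OF that] by metis
  \<comment> \<open>\<open>cover\<close> is assumed only for \<open>a \<le> b\<close>; exchanging
    the two piles, which the involutions permit, gives the other half.\<close>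
  have cover': "(\<exists>c'<c. f c' a = b) \<or> f (c div 2) (a div 2) = b div 2"
    if "b < f c a" "a < f c b"
  proof (cases "a \<le> b")
    case True
    then show ?thesis using cover less.prems that by blast
  next
    case False
    then have "(\<exists>c'<c. f c' b = a) \<or> f (c div 2) (b div 2) = a div 2"
      using cover[of c b a] less.prems that by simp
    moreover have "k < n" if "k \<le> c" for k using that less.prems by simp
    ultimately show ?thesis
      by (metis f_eq_iff less_imp_le_nat div_le_dividend)
  qed
  have "P_position {#a, b, c#} \<longleftrightarrow>
    (\<forall>a'<a. f c a' \<noteq> b) \<and> (\<forall>b'<b. f c a \<noteq> b') \<and> (\<forall>c'<c. f c' a \<noteq> b) \<and>
    ((a, b, c) \<noteq> (0, 0, 0) \<longrightarrow> f (c div 2) (a div 2) \<noteq> b div 2)"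
  proof -
    have "P_position {#a div 2, b div 2, c div 2#} \<longleftrightarrow> f (c div 2) (a div 2) = b div 2"
      if "(a, b, c) \<noteq> (0, 0, 0)"
      using that less.prems by (intro less.hyps) auto
    then show ?thesis
      by (subst P_position_iff, subst all_move_three_piles_iff) (use less in auto)
  qed
  also have "\<dots> \<longleftrightarrow> f c a = b"
  proof
    assume *: "(\<forall>a'<a. f c a' \<noteq> b) \<and> (\<forall>b'<b. f c a \<noteq> b') \<and> (\<forall>c'<c. f c' a \<noteq> b) \<and>
      ((a, b, c) \<noteq> (0, 0, 0) \<longrightarrow> f (c div 2) (a div 2) \<noteq> b div 2)"
    show "f c a = b"
    proof (rule ccontr)
      assume ne: "f c a \<noteq> b"
      then have "b < f c a" "a < f c b"
        using * f_eq_iff[OF less.prems] by (metis linorder_neqE_nat)+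
      then show False
        using * cover' by auto
    qed
  next
    assume eq: "f c a = b"
    then have "f c b = a" using f_eq_iff less.prems by blast
    then show "(\<forall>a'<a. f c a' \<noteq> b) \<and> (\<forall>b'<b. f c a \<noteq> b') \<and> (\<forall>c'<c. f c' a \<noteq> b) \<and>
      ((a, b, c) \<noteq> (0, 0, 0) \<longrightarrow> f (c div 2) (a div 2) \<noteq> b div 2)"
      using eq apart halve less.prems f_eq_iff by (metis less_irrefl)
  qed
  finally show ?case .
qed

section \<open>Candidate rows and their finite checks\<close>

text \<open>
  For \<open>a \<ge> 14\<close> this says that the \<open>k\<close> with \<open>7 * 2 ^ k \<le> a < 7 * 2 ^ (k + 1)\<close> is odd.
\<close>

function regular :: "nat \<Rightarrow> bool" where
  "regular a = (if a < 56 then a < 28 else \<not> regular (a div 2))"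
  by auto
termination by (relation "measure id") auto

declare regular.simps [simp del]

definition phi_table :: "nat list list" where
  "phi_table =
    [[0, 2, 1, 3, 4, 5, 8, 9, 6, 7, 12, 13, 10, 11, 14, 15, 16, 17, 18, 19, 20, 21, 22, 23, 24, 25, 26, 27, 30, 31],
     [2, 3, 0, 1, 5, 4, 9, 8, 7, 6, 13, 12, 11, 10, 15, 14, 17, 16, 19, 18, 21, 20, 23, 22, 25, 24, 27, 26, 31, 30],
     [1, 0, 2, 4, 3, 6, 5, 7, 8, 9, 10, 11, 12, 13, 18, 19, 20, 21, 14, 15, 16, 17, 26, 27, 28, 29, 22, 23, 24, 25],
     [3, 1, 4, 0, 2, 7, 6, 5, 9, 8, 11, 10, 13, 12, 19, 18, 21, 20, 15, 14, 17, 16, 27, 26, 29, 28, 23, 22, 25, 24],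
     [4, 5, 3, 2, 0, 1, 7, 6, 10, 11, 8, 9, 14, 15, 12, 13, 18, 19, 16, 17, 22, 23, 20, 21, 26, 27, 24, 25, 28, 29],
     [5, 4, 6, 7, 1, 0, 2, 3, 11, 10, 9, 8, 15, 14, 13, 12, 19, 18, 17, 16, 23, 22, 21, 20, 27, 26, 25, 24, 29, 28],
     [8, 9, 5, 6, 7, 2, 3, 4, 0, 1, 16, 17, 18, 19, 20, 21, 10, 11, 12, 13, 14, 15, 24, 25, 22, 23, 28, 29, 26, 27],
     [9, 8, 7, 5, 6, 3, 4, 2, 1, 0, 17, 16, 19, 18, 21, 20, 11, 10, 13, 12, 15, 14, 25, 24, 23, 22, 29, 28, 27, 26]]"

definition phi :: "nat \<Rightarrow> nat \<Rightarrow> nat" where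
  "phi c a =
    (if a < 30 then phi_table ! c ! a
     else if c < 4 then xor a (if regular a then c else xor c 2)
     else shifted_xor 2 a (c - 2))"

lemma phi_7: "phi 7 = phi7"
  by (simp add: fun_eq_iff phi_def phi7_def phi_table_def)

text \<open>
  The displacement \<open>phi c a - a\<close> for \<open>a \<ge> 30\<close>, where \<open>t = regular a\<close> and \<open>r = a mod 8\<close>.
\<close>

definition delta :: "int \<Rightarrow> bool \<Rightarrow> int \<Rightarrow> int" where
  "delta c t r =
    (if c < 4 then xor r (if t then c else xor c 2) - r else xor (r + 2) (c - 2) - (r + 2))"

text \<open>The four hypotheses of \<open>P_position_three_piles_iff\<close> for the row
  \<open>c\<close> at the point \<open>a\<close>, with lists as ranges so that they can be
  evaluated.\<close>

definition phi_laws_at :: "nat \<Rightarrow> nat \<Rightarrow> bool" where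
  "phi_laws_at c a \<longleftrightarrow>
     phi c (phi c a) = a \<and> (\<forall>c'\<in>set [0..<c]. phi c' a \<noteq> phi c a) \<and>
     ((a, phi c a, c) \<noteq> (0, 0, 0) \<longrightarrow> phi (c div 2) (a div 2) \<noteq> phi c a div 2) \<and>
     (\<forall>b\<in>set [a..<phi c a]. a < phi c b \<longrightarrow>
        (\<exists>c'\<in>set [0..<c]. phi c' a = b) \<or> phi (c div 2) (a div 2) = b div 2)"

lemma phi_laws_below_64: "\<forall>c\<in>set [0..<8]. \<forall>a\<in>set [0..<64]. phi_laws_at c a"
  \<comment> \<open>The split into ground instances keeps \<open>code_simp\<close> from unfolding under binders.\<close>
  by (simp add: upt_rec; intro conjI; code_simp)

text \<open>
  The same four laws for \<open>a \<ge> 64\<close> with \<open>r = a mod 16\<close> and \<open>b = a + j\<close>. The flag is negated after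
  halving, and the conditions on \<open>- d\<close> and \<open>(r + d) div 4\<close> keep \<open>phi c a\<close> above 30 and, for \<open>c < 4\<close>, in the
  block of four of \<open>a\<close>, on which \<open>regular\<close> is constant.
\<close>

definition delta_laws_at :: "int \<Rightarrow> int \<Rightarrow> bool \<Rightarrow> bool" where
  "delta_laws_at c r t \<longleftrightarrow>
     (let d = delta c t (r mod 8) in
      delta c t ((r + d) mod 8) = - d \<and> - d \<le> 5 \<and> (c < 4 \<longrightarrow> (r + d) div 4 = r div 4) \<and>
      (\<forall>c'\<in>{0..c - 1}. delta c' t (r mod 8) \<noteq> d) \<and>
      r div 2 + delta (c div 2) (\<not> t) (r div 2 mod 8) \<noteq> (r + d) div 2 \<and>
      (\<forall>j\<in>{0..d - 1}. 0 < j + delta c t ((r + j) mod 8) \<longrightarrow>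
        (\<exists>c'\<in>{0..c - 1}. delta c' t (r mod 8) = j) \<or>
        r div 2 + delta (c div 2) (\<not> t) (r div 2 mod 8) = (r + j) div 2))"

lemma delta_laws: "\<forall>c\<in>set [0..7]. \<forall>r\<in>set [0..15]. \<forall>t. delta_laws_at c r t"
  by (simp add: upto.simps all_bool_eq; intro conjI; code_simp)

section \<open>Dependence of the displacement on residue and parity\<close>

text \<open>An argument below 8 touches only the three lowest bits, so the displacement it causes
  depends on \<open>x mod 8\<close> alone.\<close>

lemma xor_eq_block:
  fixes x d :: nat
  assumes "d < 8"
  shows "xor x d = 8 * (x div 8) + xor (x mod 8) d"
proof -
  have "xor x d div 8 = x div 8"
    using drop_bit_xor[of 3 x d] assms by (simp add: drop_bit_eq_div)
  moreover have "xor x d mod 8 = xor (x mod 8) d"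
    using take_bit_xor[of 3 x d] assms by (simp add: take_bit_eq_mod)
  ultimately show ?thesis
    by (metis div_mult_mod_eq mult.commute)
qed

lemma int_xor_diff_cong:
  fixes x y d :: nat
  assumes "d < 8" "x mod 8 = y mod 8"
  shows "int (xor x d) - int x = int (xor y d) - int y"
proof -
  have "int (xor z d) - int z = int (xor (z mod 8) d) - int (z mod 8)" for z
    using xor_eq_block[OF assms(1), of z] div_mult_mod_eq[of z 8] by linarith
  from this[of x] this[of y] show ?thesis using assms(2) by simp
qed

lemma int_phi:
  assumes "30 \<le> a" "c < 8"
  shows "int (phi c a) = int a + delta (int c) (regular a) (int a mod 8)"
proof (cases "c < 4")
  case True
  then consider "c = 0" | "c = 1" | "c = 2" | "c = 3" by linarith
  then have "xor c 2 < 8" by cases simp_all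
  then show ?thesis
    using assms True int_xor_diff_cong[of c a "a mod 8"] int_xor_diff_cong[of "xor c 2" a "a mod 8"]
    by (simp add: phi_def delta_def of_nat_xor_eq zmod_int)
next
  case False
  \<comment> \<open>\<open>a mod 8 + 2\<close> may exceed 7, but only its residue matters.\<close>
  have "(a + 2) mod 8 = (a mod 8 + 2) mod 8" by (simp only: mod_add_left_eq)
  then have "int (xor (a + 2) (c - 2)) - int (a + 2) =
      int (xor (a mod 8 + 2) (c - 2)) - int (a mod 8 + 2)"
    using int_xor_diff_cong[of "c - 2" "a + 2" "a mod 8 + 2"] assms by simp
  \<comment> \<open>\<open>a + 2\<close> lies beyond the first block of eight and xor keeps it in
    its block, so \<open>shifted_xor\<close> does not truncate.\<close>
  moreover have "2 \<le> xor (a + 2) (c - 2)"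
    using xor_eq_block[of "c - 2" "a + 2"] assms by simp
  ultimately show ?thesis
    using assms False
    by (simp add: phi_def delta_def shifted_xor_def of_nat_xor_eq zmod_int of_nat_diff add.commute)
qed

text \<open>The thresholds 28 and 56 are multiples of 4, and halving keeps numbers from one block of
  four in a common block.\<close>

lemma regular_eq:
  assumes "28 \<le> a" "a div 4 = b div 4"
  shows "regular a = regular b"
  using assms
proof (induction a arbitrary: b rule: regular.induct)
  case (1 a)
  have lt_iff: "x < 4 * k \<longleftrightarrow> x div 4 < k" for x k :: nat
    by (simp add: div_less_iff_less_mult mult.commute)
  have bounds: "28 \<le> b" "b < 56 \<longleftrightarrow> a < 56"
    using 1(2,3) lt_iff[of a 7] lt_iff[of b 7] lt_iff[of a 14] lt_iff[of b 14] by auto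
  show ?case
  proof (cases "a < 56")
    case True
    then show ?thesis using bounds 1(2) by (simp add: regular.simps)
  next
    case False
    have "regular (a div 2) = regular (b div 2)"
    proof (intro 1(1))
      have "x div 2 div 4 = x div 4 div 2" for x :: nat
        by (simp add: div_mult2_eq [symmetric])
      then show "a div 2 div 4 = b div 2 div 4" using 1(3) by simp
    qed (use False in simp_all)
    then show ?thesis
      using False bounds by (simp add: regular.simps[of a] regular.simps[of b])
  qed
qed

section \<open>The four laws at every point\<close>

lemma phi_laws:
  assumes "c < 8"
  shows "phi c (phi c a) = a"
    and "c' < c \<Longrightarrow> phi c' a \<noteq> phi c a"
    and "(a, phi c a, c) \<noteq> (0, 0, 0) \<Longrightarrow> phi (c div 2) (a div 2) \<noteq> phi c a div 2"
    and "a \<le> b \<Longrightarrow> b < phi c a \<Longrightarrow> a < phi c b \<Longrightarrow>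
      (\<exists>c'<c. phi c' a = b) \<or> phi (c div 2) (a div 2) = b div 2"
proof -
  have "phi c (phi c a) = a \<and> (c' < c \<longrightarrow> phi c' a \<noteq> phi c a) \<and>
     ((a, phi c a, c) \<noteq> (0, 0, 0) \<longrightarrow> phi (c div 2) (a div 2) \<noteq> phi c a div 2) \<and>
     (a \<le> b \<longrightarrow> b < phi c a \<longrightarrow> a < phi c b \<longrightarrow>
        (\<exists>c'<c. phi c' a = b) \<or> phi (c div 2) (a div 2) = b div 2)"
  proof (cases "a < 64")
    case True
    then have "c \<in> set [0..<8]" "a \<in> set [0..<64]" using assms by simp_all
    from bspec[OF bspec[OF phi_laws_below_64 this(1)] this(2)] show ?thesis
      unfolding phi_laws_at_def by (auto simp: Ball_def Bex_def)
  next
    case False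
    \<comment> \<open>The modulus is 16 because the law after halving needs
      \<open>a div 2 mod 8\<close>; the common summand \<open>8 * k\<close> then cancels. As
      \<open>a \<ge> 64\<close>, \<open>a div 2\<close> is still at least 30.\<close>
    define C r t k where "C = int c" and "r = int a mod 16" and "t = regular a" and "k = int a div 16"
    define d where "d = delta C t (r mod 8)"
    have a: "int a = 16 * k + r" by (simp add: k_def r_def)
    have mods: "int a mod 8 = r mod 8" "(int a + e) mod 8 = (r + e) mod 8"
      "(int a + e) div 4 = 4 * k + (r + e) div 4"
      "(int a + e) div 2 = 8 * k + (r + e) div 2" for e
    proof -
      have *: "int a + e = r + e + 2 * k * 8" "int a + e = r + e + 4 * k * 4" "int a + e = r + e + 8 * k * 2" for e
        using a by simp_all
      show mod_8: "(int a + e) mod 8 = (r + e) mod 8" for e unfolding *(1) by (rule mod_mult_self1)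
      show "int a mod 8 = r mod 8" using mod_8[of 0] by simp
      show "(int a + e) div 4 = 4 * k + (r + e) div 4" unfolding *(2) by (rule div_mult_self1) simp
      show "(int a + e) div 2 = 8 * k + (r + e) div 2" unfolding *(3) by (rule div_mult_self1) simp
    qed
    have r: "r \<in> set [0..15]" unfolding r_def by simp
    have C: "C \<in> set [0..7]" using assms by (simp add: C_def)
    have L: "delta C t ((r + d) mod 8) = - d" "- d \<le> 5"
      "C < 4 \<longrightarrow> (r + d) div 4 = r div 4"
      "\<forall>c'\<in>{0..C - 1}. delta c' t (r mod 8) \<noteq> d"
      "r div 2 + delta (C div 2) (\<not> t) (r div 2 mod 8) \<noteq> (r + d) div 2"
      "\<forall>j\<in>{0..d - 1}. 0 < j + delta C t ((r + j) mod 8) \<longrightarrow>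
        (\<exists>c'\<in>{0..C - 1}. delta c' t (r mod 8) = j) \<or>
        r div 2 + delta (C div 2) (\<not> t) (r div 2 mod 8) = (r + j) div 2"
      using spec[OF bspec[OF bspec[OF delta_laws C] r], of t, unfolded delta_laws_at_def Let_def, folded d_def]
      by blast+
    have phi: "int (phi c' a) = int a + delta (int c') t (r mod 8)" if "c' \<le> c" for c'
      using int_phi[of a c'] that assms False mods(1) by (simp add: t_def)
    then have b: "int (phi c a) = int a + d" by (simp add: d_def C_def)
    have half: "int (phi (c div 2) (a div 2)) =
        8 * k + (r div 2 + delta (C div 2) (\<not> t) (r div 2 mod 8))"
    proof -
      have "regular (a div 2) = (\<not> t)"
        using False by (simp add: t_def regular.simps[of a])
      moreover have "int (a div 2) = 8 * k + r div 2"
        using mods(4)[of 0] by (simp add: zdiv_int)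
      ultimately show ?thesis
        using int_phi[of "a div 2" "c div 2"] False assms by (simp add: C_def zdiv_int)
    qed
    \<comment> \<open>The flag matters only for \<open>c < 4\<close>, where \<open>phi c a\<close>
      and every \<open>b\<close> between it and \<open>a\<close> share the block of four of
      \<open>a\<close>.\<close>
    have same: "delta C (regular b) x = delta C t x" if "c < 4 \<Longrightarrow> b div 4 = a div 4" for b x
    proof (cases "c < 4")
      case True
      then show ?thesis using regular_eq[of a b] that False by (simp add: t_def)
    next
      case False
      then show ?thesis by (simp add: delta_def C_def)
    qed
    have block: "phi c a div 4 = a div 4" if "c < 4"
    proof -
      have "int (phi c a) div 4 = int a div 4"
        using L(3) that mods(3)[of d] mods(3)[of 0] b by (simp add: C_def)
      then show ?thesis by (metis nat_int_comparison(1) zdiv_int of_nat_numeral)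
    qed
    have "phi c (phi c a) = a"
    proof -
      have "30 \<le> phi c a" using b L(2) False by linarith
      then have "int (phi c (phi c a)) = int (phi c a) + delta C t ((r + d) mod 8)"
        using int_phi[of "phi c a" c] assms same block b mods(2) by (simp add: C_def)
      then show ?thesis using L(1) b by simp
    qed
    moreover have "phi c' a \<noteq> phi c a" if "c' < c"
    proof -
      have "int c' \<in> {0..C - 1}" using that by (simp add: C_def)
      then have "delta (int c') t (r mod 8) \<noteq> d" using L(4) by blast
      then show ?thesis using phi[of c'] b that by auto
    qed
    moreover have "phi (c div 2) (a div 2) \<noteq> phi c a div 2"
    proof -
      have "int (phi c a div 2) = 8 * k + (r + d) div 2"
        using mods(4)[of d] b by (simp add: zdiv_int)
      then show ?thesis using half L(5) by auto
    qed
    moreover have "(\<exists>c'<c. phi c' a = b) \<or> phi (c div 2) (a div 2) = b div 2"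
      if "a \<le> b" "b < phi c a" "a < phi c b"
    proof -
      define j where "j = int b - int a"
      have bj: "int b = int a + j" by (simp add: j_def)
      have j: "j \<in> {0..d - 1}" using that b by (simp add: j_def)
      have "b div 4 = a div 4" if "c < 4"
        using block[OF that] div_le_mono[of a b 4] div_le_mono[of b "phi c a" 4] \<open>a \<le> b\<close> \<open>b < phi c a\<close>
        by simp
      then have "int (phi c b) = int b + delta C t ((r + j) mod 8)"
        using int_phi[of b c] assms same that False bj mods(2) by (simp add: C_def)
      then have "0 < j + delta C t ((r + j) mod 8)"
        using that bj by simp
      then consider c' where "c' \<in> {0..C - 1}" "delta c' t (r mod 8) = j" |
          "r div 2 + delta (C div 2) (\<not> t) (r div 2 mod 8) = (r + j) div 2"
        using L(6) j by blast
      then show ?thesis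
      proof cases
        case 1
        then have "nat c' < c" "int (nat c') = c'" by (auto simp: C_def)
        then show ?thesis using phi[of "nat c'"] 1(2) bj by force
      next
        case 2
        have "int (b div 2) = 8 * k + (r + j) div 2"
          using mods(4)[of j] bj by (simp add: zdiv_int)
        then show ?thesis using half 2 by simp
      qed
    qed
    ultimately show ?thesis by blast
  qed
  then show "phi c (phi c a) = a"
    and "c' < c \<Longrightarrow> phi c' a \<noteq> phi c a"
    and "(a, phi c a, c) \<noteq> (0, 0, 0) \<Longrightarrow> phi (c div 2) (a div 2) \<noteq> phi c a div 2"
    and "a \<le> b \<Longrightarrow> b < phi c a \<Longrightarrow> a < phi c b \<Longrightarrow>
      (\<exists>c'<c. phi c' a = b) \<or> phi (c div 2) (a div 2) = b div 2"
    by blast+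
qed

section \<open>The row \<open>c = 7\<close> and its xor form\<close>

theorem theorem32:
  shows "(\<forall>a b. P_position {#a, b, 7#} \<longleftrightarrow> b = phi7 a) \<and>
    (\<forall>a b. 30 \<le> a \<and> 30 \<le> b \<longrightarrow> (P_position {#a, b, 7#} \<longleftrightarrow> xor (a + 2) (b + 2) = 5))"
proof -
  have P_iff: "P_position {#a, b, 7#} \<longleftrightarrow> b = phi7 a" for a b
    using P_position_three_piles_iff[of 8 phi 7 a b, OF phi_laws] by (auto simp: phi_7)
  moreover have "b = phi7 a \<longleftrightarrow> xor (a + 2) (b + 2) = 5" if "30 \<le> a" for a b
  proof -
    have "b = phi7 a \<longleftrightarrow> b + 2 = xor (a + 2) 5"
      using shifted_xor_2_5[OF that] that by (auto simp: phi7_def)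
    also have "\<dots> \<longleftrightarrow> xor (a + 2) (b + 2) = 5"
      by (metis xor.assoc xor_self_eq xor.left_neutral)
    finally show ?thesis .
  qed
  ultimately show ?thesis by blast
qed

end
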